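(* If $G$ is a graph with $\Delta(G)\ge6$, then $\mu_{\mathrm{int}}(G)\le\left\lceil\frac{\Delta(G)}{2}\right\rceil$.
   Context: Graphs are finite and simple; $\Delta(G)$ is the maximum degree. A $k$-improper edge coloring of $G$ is a map $\alpha:E(G)\to\mathbb{N}$ such that at most $k$ edges with a common endpoint receive the same color; it is an improper interval coloring if at every vertex the colors on incident edges form a set of consecutive integers. $\mu_{\mathrm{int}}(G)$ is the smallest $k$ such that $G$ has a $k$-improper interval edge coloring. *)

theory Defs
  imports Complex_Main "HOL-Library.Ramsey"
begin

text \<open>Edges are 2-element sets of vertices: \<open>[V]\<^bsup>2\<^esup>\<close> is the library's notation for the set of
  all 2-element subsets of \<open>V\<close>, so loops and parallel edges are excluded.\<close>

definition finite_simple_graph :: "'a set \<Rightarrow> 'a set set \<Rightarrow> bool" where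
  "finite_simple_graph V E \<longleftrightarrow> finite V \<and> E \<subseteq> [V]\<^bsup>2\<^esup>"

definition incident_edges :: "'a set set \<Rightarrow> 'a \<Rightarrow> 'a set set" where
  "incident_edges E v = {e \<in> E. v \<in> e}"

definition degree :: "'a set set \<Rightarrow> 'a \<Rightarrow> nat" where
  "degree E v = card (incident_edges E v)"

text \<open>Inserting 0 only matters for the graph without vertices, whose maximum degree is set to 0.\<close>

definition max_degree :: "'a set \<Rightarrow> 'a set set \<Rightarrow> nat" where
  "max_degree V E = Max (insert 0 (degree E ` V))"

text \<open>Colorings are total functions on vertex sets; only their values on \<open>E\<close> are ever used.\<close>

definition improper_edge_coloring ::
    "nat \<Rightarrow> 'a set \<Rightarrow> 'a set set \<Rightarrow> ('a set \<Rightarrow> nat) \<Rightarrow> bool" where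
  "improper_edge_coloring k V E \<alpha> \<longleftrightarrow>
    (\<forall>v\<in>V. \<forall>c. card {e \<in> incident_edges E v. \<alpha> e = c} \<le> k)"

text \<open>At an isolated vertex the set of colors is empty, which is the interval \<open>{a..b}\<close> with
  \<open>b < a\<close>; the condition is vacuous there.\<close>

definition interval_edge_coloring ::
    "'a set \<Rightarrow> 'a set set \<Rightarrow> ('a set \<Rightarrow> nat) \<Rightarrow> bool" where
  "interval_edge_coloring V E \<alpha> \<longleftrightarrow>
    (\<forall>v\<in>V. \<exists>a b. \<alpha> ` incident_edges E v = {a..b})"

definition improper_interval_edge_coloring ::
    "nat \<Rightarrow> 'a set \<Rightarrow> 'a set set \<Rightarrow> ('a set \<Rightarrow> nat) \<Rightarrow> bool" where
  "improper_interval_edge_coloring k V E \<alpha> \<longleftrightarrow>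
    improper_edge_coloring k V E \<alpha> \<and> interval_edge_coloring V E \<alpha>"

definition mu_int :: "'a set \<Rightarrow> 'a set set \<Rightarrow> nat" where
  "mu_int V E = (LEAST k. \<exists>\<alpha>. improper_interval_edge_coloring k V E \<alpha>)"

text \<open>The minimum defining \<open>mu_int\<close> is over a nonempty set: a constant coloring is an improper
  interval coloring with \<open>k\<close> the maximum degree.\<close>

lemma mu_int_attained:
  assumes "finite_simple_graph V E"
  shows "\<exists>\<alpha>. improper_interval_edge_coloring (mu_int V E) V E \<alpha>"
proof -
  have "card {e \<in> incident_edges E v. 0 = c} \<le> max_degree V E" if "v \<in> V" for v and c :: nat
  proof -
    have "degree E v \<le> max_degree V E"
      using assms that by (auto simp: max_degree_def finite_simple_graph_def intro: Max_ge)
    then show ?thesis by (cases "c = 0") (simp_all add: degree_def)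
  qed
  moreover have "\<exists>a b. (\<lambda>_. 0::nat) ` incident_edges E v = {a..b}" for v
  proof (cases "incident_edges E v = {}")
    case True
    then have "(\<lambda>_. 0::nat) ` incident_edges E v = {1..0}" by simp
    then show ?thesis by blast
  next
    case False
    then have "(\<lambda>_. 0::nat) ` incident_edges E v = {0..0}" by auto
    then show ?thesis by blast
  qed
  ultimately have "improper_interval_edge_coloring (max_degree V E) V E (\<lambda>_. 0)"
    unfolding improper_interval_edge_coloring_def improper_edge_coloring_def
      interval_edge_coloring_def by blast
  then have "\<exists>\<alpha>. improper_interval_edge_coloring (max_degree V E) V E \<alpha>" by blast
  then show ?thesis unfolding mu_int_def by (rule LeastI)
qed

end

theory Submission
  imports Defs "HOL-Library.Disjoint_Sets"
begin

text \<open>Let \<open>k = \<lceil>\<Delta>/2\<rceil>\<close>, and call a vertex full if its degree is \<open>2k\<close>. A maximal matching \<open>M\<close>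
  among the edges joining two full vertices gets color 0. In \<open>E - M\<close> the vertices that still have
  degree \<open>2k\<close> are independent. The edges of \<open>E - M\<close> are colored with 1 and 2 such that the two
  color degrees agree at the independent full vertices and differ by at most 2 elsewhere. Then no color
  degree exceeds \<open>k\<close>, and a vertex on an edge of \<open>M\<close> sees all of 0, 1, 2, since it keeps
  \<open>2k - 1 > k\<close> edges.

  For this 2-coloring, let signs stand for colors and edges for vectors of \<open>\<ell>\<^sub>1\<close>-norm 2. As in the
  Beck--Fiala theorem, two vectors that share a coordinate can be tied together with a relative sign
  so that their combination has norm at most 2 again; if no two share a coordinate, any signs work.
  Tying first at the independent full vertices, where the degrees are even, makes the sums there vanish.\<close>

section \<open>Choosing signs for integer vectors of small norm\<close>

text \<open>Giving \<open>j\<close> the sign \<open>\<epsilon> i * s\<close> makes the terms of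
  \<open>i\<close> and \<open>j\<close> add up to \<open>\<epsilon> i\<close> times the combined
  vector. So signs for the shorter family, with the combined vector at \<open>i\<close>, lift to the
  whole family without changing any sum.\<close>

lemma signed_sum_merge:
  fixes f :: "'i \<Rightarrow> 'v \<Rightarrow> int" and \<epsilon> :: "'i \<Rightarrow> int"
  assumes "finite I" "i \<in> I" "j \<in> I" "i \<noteq> j" "s \<in> {1, -1}" "\<forall>l. \<epsilon> l \<in> {1, -1}"
  obtains \<epsilon>' :: "'i \<Rightarrow> int" where "\<forall>l. \<epsilon>' l \<in> {1, -1}"
    "\<And>v. (\<Sum>l\<in>I. \<epsilon>' l * f l v) = (\<Sum>l\<in>I - {j}. \<epsilon> l * (f(i := \<lambda>v. f i v + s * f j v)) l v)"
proof
  let ?\<epsilon> = "\<epsilon>(j := \<epsilon> i * s)"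
  show "\<forall>l. ?\<epsilon> l \<in> {1, -1}" using assms(5,6) by auto
  show "(\<Sum>l\<in>I. ?\<epsilon> l * f l v) = (\<Sum>l\<in>I - {j}. \<epsilon> l * (f(i := \<lambda>v. f i v + s * f j v)) l v)" for v
  proof -
    define K where "K = I - {i, j}"
    have K: "finite K" "i \<notin> K" "j \<notin> K" "I = insert j (insert i K)" "I - {j} = insert i K"
      using assms by (auto simp: K_def)
    have "(\<Sum>l\<in>K. ?\<epsilon> l * f l v) = (\<Sum>l\<in>K. \<epsilon> l * (f(i := \<lambda>v. f i v + s * f j v)) l v)"
      using K by (intro sum.cong) auto
    then show ?thesis
      using K assms(4) unfolding K(5) by (simp add: K(4) algebra_simps)
  qed
qed

text \<open>The triangle inequality at every coordinate other than \<open>v\<close> carries the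
  saving of 2 at \<open>v\<close> over to the whole norm.\<close>

lemma sum_abs_add_cancel:
  fixes f g :: "'v \<Rightarrow> int"
  assumes "finite V" "v \<in> V" "\<bar>f v + s * g v\<bar> \<le> \<bar>f v\<bar> + \<bar>g v\<bar> - 2" "s \<in> {1, -1}"
  shows "(\<Sum>u\<in>V. \<bar>f u + s * g u\<bar>) \<le> (\<Sum>u\<in>V. \<bar>f u\<bar>) + (\<Sum>u\<in>V. \<bar>g u\<bar>) - 2"
proof -
  have "(\<Sum>u\<in>V - {v}. \<bar>f u + s * g u\<bar>) \<le> (\<Sum>u\<in>V - {v}. \<bar>f u\<bar> + \<bar>g u\<bar>)"
    using assms(4) by (intro sum_mono) auto
  then show ?thesis
    using assms(3) by (simp add: sum.distrib sum.remove[OF assms(1,2)])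
qed

text \<open>Choose \<open>s\<close> so that \<open>a\<close> and \<open>s * b\<close> have opposite
  signs: the absolute value then drops by twice the smaller of the two, which is at least 1.\<close>

lemma cancelling_sign:
  fixes a b :: int
  assumes "a \<noteq> 0" "b \<noteq> 0"
  obtains s :: int where "s \<in> {1, -1}" "\<bar>a + s * b\<bar> \<le> \<bar>a\<bar> + \<bar>b\<bar> - 2"
proof (cases "(a > 0) = (b > 0)")
  case True
  with assms have "\<bar>a + (-1) * b\<bar> \<le> \<bar>a\<bar> + \<bar>b\<bar> - 2" by linarith
  then show ?thesis using that[of "-1"] by blast
next
  case False
  with assms have "\<bar>a + 1 * b\<bar> \<le> \<bar>a\<bar> + \<bar>b\<bar> - 2" by linarith
  then show ?thesis using that[of 1] by blast
qed

text \<open>Induction on the number of vectors. Combining two that share a coordinate yields norm at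
  most 2 + 2 - 2, so the norm bound survives. Once the supports are pairwise disjoint, each
  coordinate sees at most one nonzero entry, of size at most 2.\<close>

lemma balancing_signs:
  fixes f :: "'i \<Rightarrow> 'v \<Rightarrow> int"
  assumes "finite V" "finite I" "\<And>i. i \<in> I \<Longrightarrow> (\<Sum>v\<in>V. \<bar>f i v\<bar>) \<le> 2"
  shows "\<exists>\<epsilon> :: 'i \<Rightarrow> int. (\<forall>i. \<epsilon> i \<in> {1, -1}) \<and> (\<forall>v\<in>V. \<bar>\<Sum>i\<in>I. \<epsilon> i * f i v\<bar> \<le> 2)"
  using assms(2,3)
proof (induction "card I" arbitrary: I f rule: less_induct)
  case less
  show ?case
  proof (cases "\<exists>i\<in>I. \<exists>j\<in>I. \<exists>v\<in>V. i \<noteq> j \<and> f i v \<noteq> 0 \<and> f j v \<noteq> 0")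
    case True
    then obtain i j v where ij: "i \<in> I" "j \<in> I" "v \<in> V" "i \<noteq> j" "f i v \<noteq> 0" "f j v \<noteq> 0"
      by blast
    obtain s :: int where s: "s \<in> {1, -1}" "\<bar>f i v + s * f j v\<bar> \<le> \<bar>f i v\<bar> + \<bar>f j v\<bar> - 2"
      using cancelling_sign ij by blast
    let ?f = "f(i := \<lambda>v. f i v + s * f j v)"
    have "(\<Sum>v\<in>V. \<bar>?f l v\<bar>) \<le> 2" if "l \<in> I - {j}" for l
      using sum_abs_add_cancel[where f = "f i" and g = "f j", OF assms(1) ij(3) s(2,1)] less.prems(2)[of l]
        less.prems(2)[of i] less.prems(2)[of j] ij that by auto
    moreover have "card (I - {j}) < card I"
      using less.prems(1) ij(2) by (rule card_Diff1_less)
    ultimately obtain \<epsilon> :: "'i \<Rightarrow> int" where \<epsilon>: "\<forall>i. \<epsilon> i \<in> {1, -1}"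
      "\<forall>v\<in>V. \<bar>\<Sum>l\<in>I - {j}. \<epsilon> l * ?f l v\<bar> \<le> 2"
      using less.hyps[of "I - {j}" ?f] less.prems(1) by blast
    obtain \<epsilon>' :: "'i \<Rightarrow> int" where "\<forall>l. \<epsilon>' l \<in> {1, -1}"
      "\<And>v. (\<Sum>l\<in>I. \<epsilon>' l * f l v) = (\<Sum>l\<in>I - {j}. \<epsilon> l * ?f l v)"
      using signed_sum_merge[OF less.prems(1) ij(1,2,4) s(1) \<epsilon>(1)] by metis
    then show ?thesis using \<epsilon>(2) by metis
  next
    case False
    have "\<bar>\<Sum>i\<in>I. f i v\<bar> \<le> 2" if v: "v \<in> V" for v
    proof (cases "\<exists>i\<in>I. f i v \<noteq> 0")
      case True
      then obtain i where i: "i \<in> I" "f i v \<noteq> 0" by blast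
      then have "(\<Sum>l\<in>I - {i}. f l v) = 0" using False v by (intro sum.neutral) blast
      then have "(\<Sum>l\<in>I. f l v) = f i v" using sum.remove[OF less.prems(1) i(1), of "\<lambda>l. f l v"] by simp
      moreover have "\<bar>f i v\<bar> \<le> (\<Sum>v\<in>V. \<bar>f i v\<bar>)"
        using assms(1) v by (intro member_le_sum) auto
      ultimately show ?thesis using less.prems(2)[OF i(1)] by linarith
    qed simp
    then show ?thesis by (intro exI[of _ "\<lambda>_. 1"]) simp
  qed
qed

text \<open>The same induction, but combining only at coordinates in \<open>S\<close>. The norm on
  \<open>S\<close> stays at most 1, in fact 1 + 1 - 2 = 0 for a combined vector. When no two vectors
  share a coordinate in \<open>S\<close>, parity forces all of them to vanish there, and
  \<open>balancing_signs\<close> handles the rest.\<close>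

lemma balancing_signs_exact:
  fixes f :: "'i \<Rightarrow> 'v \<Rightarrow> int"
  assumes "finite V" "S \<subseteq> V" "finite I"
    and "\<And>i. i \<in> I \<Longrightarrow> (\<Sum>v\<in>V. \<bar>f i v\<bar>) \<le> 2" "\<And>i. i \<in> I \<Longrightarrow> (\<Sum>v\<in>S. \<bar>f i v\<bar>) \<le> 1"
    and "\<And>v. v \<in> S \<Longrightarrow> even (\<Sum>i\<in>I. f i v)"
  shows "\<exists>\<epsilon> :: 'i \<Rightarrow> int. (\<forall>i. \<epsilon> i \<in> {1, -1}) \<and> (\<forall>v\<in>V. \<bar>\<Sum>i\<in>I. \<epsilon> i * f i v\<bar> \<le> 2)
    \<and> (\<forall>v\<in>S. (\<Sum>i\<in>I. \<epsilon> i * f i v) = 0)"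
  using assms(3-6)
proof (induction "card I" arbitrary: I f rule: less_induct)
  case less
  have finS: "finite S" using assms(1,2) finite_subset by blast
  show ?case
  proof (cases "\<exists>i\<in>I. \<exists>j\<in>I. \<exists>v\<in>S. i \<noteq> j \<and> f i v \<noteq> 0 \<and> f j v \<noteq> 0")
    case True
    then obtain i j v where ij: "i \<in> I" "j \<in> I" "v \<in> S" "i \<noteq> j" "f i v \<noteq> 0" "f j v \<noteq> 0"
      by blast
    then have vV: "v \<in> V" using assms(2) by blast
    obtain s :: int where s: "s \<in> {1, -1}" "\<bar>f i v + s * f j v\<bar> \<le> \<bar>f i v\<bar> + \<bar>f j v\<bar> - 2"
      using cancelling_sign ij by blast
    let ?f = "f(i := \<lambda>v. f i v + s * f j v)"
    have "(\<Sum>v\<in>V. \<bar>?f l v\<bar>) \<le> 2" if "l \<in> I - {j}" for l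
      using sum_abs_add_cancel[where f = "f i" and g = "f j", OF assms(1) vV s(2,1)] less.prems(2)[of l]
        less.prems(2)[of i] less.prems(2)[of j] ij that by auto
    moreover have "(\<Sum>v\<in>S. \<bar>?f l v\<bar>) \<le> 1" if "l \<in> I - {j}" for l
      using sum_abs_add_cancel[where f = "f i" and g = "f j", OF finS ij(3) s(2,1)] less.prems(3)[of l]
        less.prems(3)[of i] less.prems(3)[of j] ij that by auto
    \<comment> \<open>Combining changes the sum at \<open>u\<close> by
      \<open>(s - 1) * f j u\<close>, where \<open>s - 1\<close> is 0 or -2.\<close>
    moreover have "even (\<Sum>l\<in>I - {j}. ?f l u)" if "u \<in> S" for u
    proof -
      define K where "K = I - {i, j}"
      have K: "finite K" "i \<notin> K" "j \<notin> K" "I = insert j (insert i K)" "I - {j} = insert i K"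
        using less.prems(1) ij by (auto simp: K_def)
      have "(\<Sum>l\<in>K. ?f l u) = (\<Sum>l\<in>K. f l u)"
        using K by (intro sum.cong) auto
      then have "(\<Sum>l\<in>I - {j}. ?f l u) = (\<Sum>l\<in>I. f l u) + (s - 1) * f j u"
        using K ij(4) unfolding K(5) by (simp add: K(4) algebra_simps)
      moreover have "even (s - 1)" using s(1) by auto
      ultimately show ?thesis using less.prems(4)[OF that] by simp
    qed
    moreover have "card (I - {j}) < card I"
      using less.prems(1) ij(2) by (rule card_Diff1_less)
    ultimately obtain \<epsilon> :: "'i \<Rightarrow> int" where \<epsilon>: "\<forall>i. \<epsilon> i \<in> {1, -1}"
      "\<forall>v\<in>V. \<bar>\<Sum>l\<in>I - {j}. \<epsilon> l * ?f l v\<bar> \<le> 2" "\<forall>v\<in>S. (\<Sum>l\<in>I - {j}. \<epsilon> l * ?f l v) = 0"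
      using less.hyps[of "I - {j}" ?f] less.prems(1) by blast
    obtain \<epsilon>' :: "'i \<Rightarrow> int" where "\<forall>l. \<epsilon>' l \<in> {1, -1}"
      "\<And>v. (\<Sum>l\<in>I. \<epsilon>' l * f l v) = (\<Sum>l\<in>I - {j}. \<epsilon> l * ?f l v)"
      using signed_sum_merge[OF less.prems(1) ij(1,2,4) s(1) \<epsilon>(1)] by metis
    then show ?thesis using \<epsilon>(2,3) by metis
  next
    case False
    \<comment> \<open>A nonzero entry would be the only one at \<open>v\<close>, hence equal to the
      even sum there, while the norm bound on \<open>S\<close> makes it 1 or -1.\<close>
    have zero: "f i v = 0" if "v \<in> S" "i \<in> I" for i v
    proof (rule ccontr)
      assume nz: "f i v \<noteq> 0"
      then have "(\<Sum>l\<in>I - {i}. f l v) = 0" using False that by (intro sum.neutral) blast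
      then have "even (f i v)"
        using sum.remove[OF less.prems(1) that(2), of "\<lambda>l. f l v"] less.prems(4)[OF that(1)] by simp
      moreover have "\<bar>f i v\<bar> \<le> (\<Sum>v\<in>S. \<bar>f i v\<bar>)"
        using finS that by (intro member_le_sum) auto
      then have "\<bar>f i v\<bar> = 1" using less.prems(3)[OF that(2)] nz by linarith
      then have "odd (f i v)" by presburger
      ultimately show False by blast
    qed
    obtain \<epsilon> :: "'i \<Rightarrow> int" where "\<forall>i. \<epsilon> i \<in> {1, -1}" "\<forall>v\<in>V. \<bar>\<Sum>i\<in>I. \<epsilon> i * f i v\<bar> \<le> 2"
      using balancing_signs[of V I f] assms(1) less.prems(1,2) by metis
    moreover have "(\<Sum>i\<in>I. \<epsilon> i * f i v) = 0" if "v \<in> S" for v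
      using zero[OF that] by (intro sum.neutral) simp
    ultimately show ?thesis by metis
  qed
qed

section \<open>From signs to a bipartition of the edges\<close>

text \<open>Represent each edge by the indicator vector of its ends. Its norm is 2, and at most 1 on
  \<open>S\<close> since at most one end lies in \<open>S\<close>. The signs split \<open>H\<close>
  into two classes, and the signed sum at a vertex is the difference of its two degrees.\<close>

lemma balanced_edge_bipartition:
  fixes H :: "'a set set"
  assumes "finite V" "H \<subseteq> [V]\<^bsup>2\<^esup>" "S \<subseteq> V"
    and "\<And>e. e \<in> H \<Longrightarrow> card (e \<inter> S) \<le> 1" "\<And>v. v \<in> S \<Longrightarrow> even (degree H v)"
  obtains A B where "A \<union> B = H" "A \<inter> B = {}"
    "\<And>v. v \<in> V \<Longrightarrow> \<bar>int (degree A v) - int (degree B v)\<bar> \<le> 2"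
    "\<And>v. v \<in> S \<Longrightarrow> degree A v = degree B v"
proof -
  have "H \<subseteq> Pow V" using assms(2) by (auto simp: nsets_def)
  then have finH: "finite H" using assms(1) finite_subset by blast
  define f :: "'a set \<Rightarrow> 'a \<Rightarrow> int" where "f e v = (if v \<in> e then 1 else 0)" for e v
  have sum_f: "(\<Sum>v\<in>W. \<bar>f e v\<bar>) = int (card (e \<inter> W))" if "finite W" for e W
  proof -
    have "(\<Sum>v\<in>W. \<bar>f e v\<bar>) = (\<Sum>v\<in>W. if v \<in> e then 1 else 0)"
      by (intro sum.cong) (auto simp: f_def)
    also have "\<dots> = int (card (e \<inter> W))"
      using that by (simp add: sum.If_cases Int_commute)
    finally show ?thesis .
  qed
  have deg: "(\<Sum>e\<in>C. f e v) = int (degree C v)" if "finite C" for C v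
    using that by (simp add: f_def sum.If_cases degree_def incident_edges_def Int_def)
  have finS: "finite S" using assms(1,3) finite_subset by blast
  have "(\<Sum>v\<in>V. \<bar>f e v\<bar>) \<le> 2" if "e \<in> H" for e
  proof -
    have "e \<subseteq> V" "card e = 2" using assms(2) that by (auto simp: nsets_def)
    then show ?thesis using sum_f[OF assms(1)] by (simp add: Int_absorb2)
  qed
  moreover have "(\<Sum>v\<in>S. \<bar>f e v\<bar>) \<le> 1" if "e \<in> H" for e
    using assms(4)[OF that] sum_f[OF finS] by simp
  moreover have "even (\<Sum>e\<in>H. f e v)" if "v \<in> S" for v
    using assms(5)[OF that] deg[OF finH] by simp
  ultimately obtain \<epsilon> :: "'a set \<Rightarrow> int" where \<epsilon>: "\<forall>e. \<epsilon> e \<in> {1, -1}"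
    "\<forall>v\<in>V. \<bar>\<Sum>e\<in>H. \<epsilon> e * f e v\<bar> \<le> 2" "\<forall>v\<in>S. (\<Sum>e\<in>H. \<epsilon> e * f e v) = 0"
    using balancing_signs_exact[OF assms(1,3) finH, of f] by blast
  define A where "A = {e \<in> H. \<epsilon> e = 1}"
  define B where "B = {e \<in> H. \<epsilon> e = -1}"
  have AB: "A \<union> B = H" "A \<inter> B = {}" using \<epsilon>(1) by (auto simp: A_def B_def)
  have fin: "finite A" "finite B" using finH by (auto simp: A_def B_def)
  have "(\<Sum>e\<in>H. \<epsilon> e * f e v) = int (degree A v) - int (degree B v)" for v
  proof -
    have "(\<Sum>e\<in>H. \<epsilon> e * f e v) = (\<Sum>e\<in>A. \<epsilon> e * f e v) + (\<Sum>e\<in>B. \<epsilon> e * f e v)"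
      using AB fin sum.union_disjoint by metis
    also have "(\<Sum>e\<in>A. \<epsilon> e * f e v) = (\<Sum>e\<in>A. f e v)"
      by (intro sum.cong) (auto simp: A_def)
    also have "(\<Sum>e\<in>B. \<epsilon> e * f e v) = (\<Sum>e\<in>B. - f e v)"
      by (intro sum.cong) (auto simp: B_def)
    finally show ?thesis using deg fin by (simp add: sum_negf)
  qed
  with \<epsilon>(2,3) have "\<And>v. v \<in> V \<Longrightarrow> \<bar>int (degree A v) - int (degree B v)\<bar> \<le> 2"
    "\<And>v. v \<in> S \<Longrightarrow> degree A v = degree B v" by simp_all
  with AB show ?thesis by (rule that)
qed

section \<open>Maximal matchings and additivity of degrees\<close>

text \<open>A disjoint subfamily of largest cardinality works, since a nonempty member missing its
  union could be added. The case \<open>e = {}\<close> remains because the empty set meets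
  nothing.\<close>

lemma maximal_matching:
  assumes "finite F"
  obtains M where "M \<subseteq> F" "disjoint M" "\<And>e. e \<in> F \<Longrightarrow> e \<inter> \<Union>M = {} \<Longrightarrow> e = {}"
proof -
  define P where "P M \<longleftrightarrow> M \<subseteq> F \<and> disjoint M" for M
  have "P {}" by (simp add: P_def)
  moreover have "card M \<le> card F" if "P M" for M
    using that assms by (simp add: P_def card_mono)
  ultimately obtain M where M: "P M" "\<And>N. P N \<Longrightarrow> card N \<le> card M"
    using ex_has_greatest_nat[of P "{}" card "Suc (card F)"] by (metis le_imp_less_Suc)
  show thesis
  proof
    show "M \<subseteq> F" "disjoint M" using M(1) by (simp_all add: P_def)
    show "e = {}" if e: "e \<in> F" "e \<inter> \<Union>M = {}" for e
    proof (rule ccontr)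
      assume "e \<noteq> {}"
      with e(2) have "e \<notin> M" by auto
      moreover have "P (insert e M)"
        using e M(1) by (auto simp: P_def disjoint_def)
      moreover have "finite M" using M(1) assms finite_subset by (auto simp: P_def)
      ultimately show False using M(2)[of "insert e M"] by simp
    qed
  qed
qed

lemma degree_Un_disjoint:
  assumes "finite A" "finite B" "A \<inter> B = {}"
  shows "degree (A \<union> B) v = degree A v + degree B v"
proof -
  have "incident_edges (A \<union> B) v = incident_edges A v \<union> incident_edges B v"
    by (auto simp: incident_edges_def)
  then show ?thesis
    using assms unfolding degree_def
    by (simp add: card_Un_disjoint incident_edges_def disjoint_iff)
qed

section \<open>Construction of the coloring\<close>

lemma exists_improper_interval_edge_coloring:
  assumes "finite_simple_graph V E" "k \<ge> 2" "\<And>v. v \<in> V \<Longrightarrow> degree E v \<le> 2 * k"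
  shows "\<exists>\<alpha>. improper_interval_edge_coloring k V E \<alpha>"
proof -
  have V: "finite V" and E: "E \<subseteq> [V]\<^bsup>2\<^esup>"
    using assms(1) by (auto simp: finite_simple_graph_def)
  then have "E \<subseteq> Pow V" by (auto simp: nsets_def)
  then have finE: "finite E" using V finite_subset by blast
  have card2: "card e = 2" if "e \<in> E" for e using E that by (auto simp: nsets_def)
  define F where "F = {e \<in> E. \<forall>v\<in>e. degree E v = 2 * k}"
  have "finite F" using finE by (simp add: F_def)
  then obtain M where M: "M \<subseteq> F" "disjoint M"
    and maxM: "\<And>e. e \<in> F \<Longrightarrow> e \<inter> \<Union>M = {} \<Longrightarrow> e = {}"
    using maximal_matching by metis
  have ME: "M \<subseteq> E" using M(1) by (auto simp: F_def)
  then have finM: "finite M" using finE finite_subset by blast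
  define H where "H = E - M"
  have degE: "degree E v = degree M v + degree H v" for v
    using degree_Un_disjoint[of M H v] ME finE finM by (simp add: H_def Un_absorb1)
  have deg_covered: "degree M v = 1" "degree E v = 2 * k" if "v \<in> \<Union>M" for v
  proof -
    from that obtain e where e: "e \<in> M" "v \<in> e" by blast
    then have "incident_edges M v = {e}"
      using M(2) by (auto simp: incident_edges_def disjoint_def)
    then show "degree M v = 1" by (simp add: degree_def)
    show "degree E v = 2 * k" using e M(1) by (auto simp: F_def)
  qed
  have deg_uncovered: "degree M v = 0" if "v \<notin> \<Union>M" for v
  proof -
    have "incident_edges M v = {}" using that by (auto simp: incident_edges_def)
    then show ?thesis by (simp add: degree_def)
  qed
  \<comment> \<open>These are the vertices that still have degree \<open>2 * k\<close> in
    \<open>H\<close>. An edge joining two of them would lie in \<open>F\<close> and miss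
    \<open>M\<close>, against maximality.\<close>
  define S where "S = {v \<in> V. degree E v = 2 * k} - \<Union>M"
  have indep: "card (e \<inter> S) \<le> 1" if e: "e \<in> H" for e
  proof (rule ccontr)
    have eE: "e \<in> E" using e by (simp add: H_def)
    then have fe: "finite e" using card2 card.infinite by fastforce
    assume "\<not> card (e \<inter> S) \<le> 1"
    then have "card e \<le> card (e \<inter> S)" using card2[OF eE] by simp
    then have "e \<inter> S = e" using fe by (intro card_seteq) auto
    then have "e \<subseteq> S" by blast
    then have "e \<in> F" "e \<inter> \<Union>M = {}" using eE by (auto simp: F_def S_def)
    then have "e = {}" by (rule maxM)
    then show False using card2[OF eE] by simp
  qed
  have HV: "H \<subseteq> [V]\<^bsup>2\<^esup>" and SV: "S \<subseteq> V" using E by (auto simp: H_def S_def)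
  have "even (degree H v)" if "v \<in> S" for v
  proof -
    from that have "degree E v = 2 * k" "degree M v = 0" using deg_uncovered by (auto simp: S_def)
    then have "degree H v = 2 * k" using degE[of v] by simp
    then show ?thesis by simp
  qed
  then obtain A B where AB: "A \<union> B = H" "A \<inter> B = {}"
    and near: "\<And>v. v \<in> V \<Longrightarrow> \<bar>int (degree A v) - int (degree B v)\<bar> \<le> 2"
    and eq: "\<And>v. v \<in> S \<Longrightarrow> degree A v = degree B v"
    using balanced_edge_bipartition[OF V HV SV indep] by metis
  have fin: "finite A" "finite B" using AB(1) finE by (auto simp: H_def intro: finite_subset)
  have degH: "degree H v = degree A v + degree B v" for v
    using degree_Un_disjoint[OF fin AB(2)] AB(1) by simp
  \<comment> \<open>On \<open>S\<close> the two degrees are equal with sum at most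
    \<open>2 * k\<close>. Elsewhere the sum is at most \<open>2 * k - 1\<close> and the difference
    at most 2, so the larger degree is at most \<open>k + 1/2\<close>, hence at most
    \<open>k\<close>.\<close>
  have bound: "degree A v \<le> k \<and> degree B v \<le> k" if v: "v \<in> V" for v
  proof (cases "v \<in> S")
    case True
    then show ?thesis using eq[OF True] degH[of v] degE[of v] assms(3)[OF v] by linarith
  next
    case False
    \<comment> \<open>A vertex covered by \<open>M\<close> loses its matching edge; an uncovered
      vertex outside \<open>S\<close> was not full to begin with.\<close>
    then have "degree H v < 2 * k"
      using deg_covered[of v] degE[of v] assms(2) assms(3)[OF v] v by (cases "v \<in> \<Union>M") (auto simp: S_def)
    then show ?thesis using near[OF v] degH[of v] by linarith
  qed
  define \<alpha> :: "'a set \<Rightarrow> nat" where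
    "\<alpha> e = (if e \<in> M then 0 else if e \<in> A then 1 else 2)" for e
  have "card {e \<in> incident_edges E v. \<alpha> e = c} \<le> k" if v: "v \<in> V" for v c
  proof -
    consider "c = 0" | "c = 1" | "c = 2" | "c > 2" by linarith
    then show ?thesis
    proof cases
      case 1
      then have "{e \<in> incident_edges E v. \<alpha> e = c} = incident_edges M v"
        using ME by (auto simp: \<alpha>_def incident_edges_def)
      moreover have "degree M v \<le> 1" using deg_uncovered[of v] deg_covered[of v] by fastforce
      ultimately show ?thesis using assms(2) by (simp add: degree_def)
    next
      case 2
      then have "{e \<in> incident_edges E v. \<alpha> e = c} = incident_edges A v"
        using AB by (auto simp: \<alpha>_def incident_edges_def H_def)
      then show ?thesis using bound[OF v] by (simp add: degree_def)
    next
      case 3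
      then have "{e \<in> incident_edges E v. \<alpha> e = c} = incident_edges B v"
        using AB by (auto simp: \<alpha>_def incident_edges_def H_def)
      then show ?thesis using bound[OF v] by (simp add: degree_def)
    next
      case 4
      then have none: "{e \<in> incident_edges E v. \<alpha> e = c} = {}"
        by (auto simp: \<alpha>_def)
      show ?thesis unfolding none by simp
    qed
  qed
  moreover have "\<exists>a b. \<alpha> ` incident_edges E v = {a..b}" if v: "v \<in> V" for v
  proof (cases "v \<in> \<Union>M")
    case True
    \<comment> \<open>The \<open>2 * k - 1\<close> remaining edges at \<open>v\<close> exceed
      \<open>k\<close> because \<open>k \<ge> 2\<close>, so neither class, having at most
      \<open>k\<close> of them, can contain them all.\<close>
    then have "degree M v > 0" "degree A v > 0" "degree B v > 0"
      using deg_covered[OF True] degE[of v] degH[of v] bound[OF v] assms(2) by linarith+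
    then have "incident_edges M v \<noteq> {}" "incident_edges A v \<noteq> {}" "incident_edges B v \<noteq> {}"
      by (auto simp: degree_def)
    then obtain e0 e1 e2 where e: "e0 \<in> incident_edges M v" "e1 \<in> incident_edges A v"
      "e2 \<in> incident_edges B v" by blast
    then have "\<alpha> e0 = 0" "\<alpha> e1 = 1" "\<alpha> e2 = 2" "{e0, e1, e2} \<subseteq> incident_edges E v"
      using AB ME by (auto simp: \<alpha>_def incident_edges_def H_def)
    then have "{0, 1, 2} \<subseteq> \<alpha> ` incident_edges E v" by force
    moreover have "\<alpha> ` incident_edges E v \<subseteq> {0..2}" by (auto simp: \<alpha>_def)
    moreover have "{0..2::nat} = {0, 1, 2}" by auto
    ultimately have "\<alpha> ` incident_edges E v = {0..2}" by (metis subset_antisym)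
    then show ?thesis by blast
  next
    case False
    then have "\<alpha> ` incident_edges E v \<subseteq> {1, 2}" by (auto simp: \<alpha>_def incident_edges_def)
    \<comment> \<open>Away from \<open>M\<close> one or both of the colors 1 and 2 may be missing,
      but every subset of two consecutive integers is an interval.\<close>
    moreover have "\<exists>a b. X = {a..b}" if "X \<subseteq> {1, 2}" for X :: "nat set"
    proof -
      have "X = {} \<or> X = {1} \<or> X = {2} \<or> X = {1, 2}" using that by blast
      moreover have "{} = {1..0::nat}" "{1} = {1..1::nat}" "{2} = {2..2::nat}" "{1, 2} = {1..2::nat}"
        by auto
      ultimately show ?thesis by metis
    qed
    ultimately show ?thesis by blast
  qed
  ultimately show ?thesis
    unfolding improper_interval_edge_coloring_def improper_edge_coloring_def
      interval_edge_coloring_def by blast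
qed

theorem theorem25:
  fixes V :: "'a set" and E :: "'a set set"
  assumes "finite_simple_graph V E"
    and "max_degree V E \<ge> 6"
  shows "int (mu_int V E) \<le> \<lceil>real (max_degree V E) / 2\<rceil>"
proof -
  \<comment> \<open>Rounding up gives \<open>max_degree V E \<le> 2 * k\<close>, so for odd maximum
    degree no vertex is full and the matching is empty.\<close>
  define k where "k = nat \<lceil>real (max_degree V E) / 2\<rceil>"
  have k: "int k = \<lceil>real (max_degree V E) / 2\<rceil>" "max_degree V E \<le> 2 * k"
    unfolding k_def by linarith+
  have "degree E v \<le> max_degree V E" if "v \<in> V" for v
    using assms(1) that by (auto simp: max_degree_def finite_simple_graph_def intro: Max_ge)
  then have "degree E v \<le> 2 * k" if "v \<in> V" for v
    using that k(2) order_trans by blast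
  moreover have "k \<ge> 2" using assms(2) k(2) by linarith
  ultimately have "\<exists>\<alpha>. improper_interval_edge_coloring k V E \<alpha>"
    using exists_improper_interval_edge_coloring[OF assms(1)] by blast
  then have "mu_int V E \<le> k" unfolding mu_int_def by (rule Least_le)
  then show ?thesis using k(1) by linarith
qed

end
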